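(* On the set of grid functions $w$ vanishing on $\partial\omega$, let the operator $A$ be defined for $x\in\omega$ either by $$Aw=-\frac1{h^2}k(x+0.5h)\exp(\theta(x,t)h)(w(x+h)-w(x))+\frac1{h^2}k(x-0.5h)\exp(-\theta(x,t)h)(w(x)-w(x-h))\qquad(\mathrm a)$$ or by $$\begin{aligned}Aw=&-\frac1{h^2}k(x+0.5h)\exp(-\theta(x+h,t)h)w(x+h)+\frac1{h^2}k(x+0.5h)\exp(\theta(x,t)h)w(x)\\&+\frac1{h^2}k(x-0.5h)\exp(-\theta(x,t)h)w(x)-\frac1{h^2}k(x-0.5h)\exp(\theta(x-h,t)h)w(x-h).\end{aligned}\qquad(\mathrm b)$$ Then the difference scheme $$\frac{y^{n+1}-y^n}\tau+A(\sigma y^{n+1}+(1-\sigma)y^n)=\varphi^n,\quad n=0,1,\dots,\qquad y^0=u^0,$$ is monotone, and its solution satisfies $$\|y^{n+1}\|\le\|u^0\|+\sum_{k=0}^n\tau\|\varphi^k\|$$ in $L_\infty$ in case (a) (respectively, in $L_1$ in case (b)), for any $\tau>0$ if $\sigma=1$, and, if $0\le\sigma<1$, under the time-step constraint $$\tau\le\frac1{(1-\sigma)\gamma},\qquad \gamma=\max_{x\in\omega}\frac1{h^2}\big(k(x+0.5h)\exp(\theta(x,t)h)+k(x-0.5h)\exp(-\theta(x,t)h)\big).$$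
   Context: $\bar\omega=\{ih: i=0,\dots,N\}$, $Nh=l$, $\omega=\{ih: i=1,\dots,N-1\}$, $\partial\omega=\{0,l\}$. $k(x)\ge\kappa_1>0$ and $v(x,t)$ are given real functions on $[0,l]$ and $[0,l]\times[0,T]$, and $\theta(x,t)=\frac{v(x,t)}{2k(x)}$. Grid functions are identified with vectors indexed by $\omega$, with $\|w\|_\infty=\max_{x\in\omega}|w(x)|$ and $\|w\|_1=\sum_{x\in\omega}|w(x)|$. $\tau>0$ is the time step, $t^n=n\tau$; in the step from $t^n$ to $t^{n+1}$ the operator $A$ is taken e.g. at $t=\sigma t^{n+1}+(1-\sigma)t^n$, and the time-step constraint is required at these times. The scheme is monotone if $u^0\ge0$ and $\varphi^n\ge0$ for all $n$ imply $y^{n+1}\ge0$ for all $n$. *)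

theory Defs
  imports Complex_Main
begin

text \<open>
  Grid functions are modelled as functions on the reals of which only the values at the
  grid points \<open>i h\<close>, \<open>i = 0, \<dots>, N\<close>, matter. The grid on \<open>[0, l]\<close> is given by \<open>N\<close> and \<open>h\<close>
  with \<open>N h = l\<close>.
\<close>

definition grid_int :: "nat \<Rightarrow> real \<Rightarrow> real set" where
  "grid_int N h = {real i * h | i. 1 \<le> i \<and> i < N}"

definition grid_bdry :: "nat \<Rightarrow> real \<Rightarrow> real set" where
  "grid_bdry N h = {0, real N * h}"

definition norm_inf :: "nat \<Rightarrow> real \<Rightarrow> (real \<Rightarrow> real) \<Rightarrow> real" where
  "norm_inf N h w = Max ((\<lambda>x. \<bar>w x\<bar>) ` grid_int N h)"

definition norm_one :: "nat \<Rightarrow> real \<Rightarrow> (real \<Rightarrow> real) \<Rightarrow> real" where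
  "norm_one N h w = (\<Sum>x\<in>grid_int N h. \<bar>w x\<bar>)"

definition theta :: "(real \<Rightarrow> real) \<Rightarrow> (real \<Rightarrow> real \<Rightarrow> real) \<Rightarrow> real \<Rightarrow> real \<Rightarrow> real" where
  "theta k v x t = v x t / (2 * k x)"

definition op_a ::
  "(real \<Rightarrow> real) \<Rightarrow> (real \<Rightarrow> real \<Rightarrow> real) \<Rightarrow> real \<Rightarrow> real \<Rightarrow> (real \<Rightarrow> real) \<Rightarrow> real \<Rightarrow> real" where
  "op_a k v h t w x =
     - (1 / h^2) * k (x + 0.5 * h) * exp (theta k v x t * h) * (w (x + h) - w x)
     + (1 / h^2) * k (x - 0.5 * h) * exp (- theta k v x t * h) * (w x - w (x - h))"

definition op_b ::
  "(real \<Rightarrow> real) \<Rightarrow> (real \<Rightarrow> real \<Rightarrow> real) \<Rightarrow> real \<Rightarrow> real \<Rightarrow> (real \<Rightarrow> real) \<Rightarrow> real \<Rightarrow> real" where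
  "op_b k v h t w x =
     - (1 / h^2) * k (x + 0.5 * h) * exp (- theta k v (x + h) t * h) * w (x + h)
     + (1 / h^2) * k (x + 0.5 * h) * exp (theta k v x t * h) * w x
     + (1 / h^2) * k (x - 0.5 * h) * exp (- theta k v x t * h) * w x
     - (1 / h^2) * k (x - 0.5 * h) * exp (theta k v (x - h) t * h) * w (x - h)"

definition gamma_max ::
  "(real \<Rightarrow> real) \<Rightarrow> (real \<Rightarrow> real \<Rightarrow> real) \<Rightarrow> nat \<Rightarrow> real \<Rightarrow> real \<Rightarrow> real" where
  "gamma_max k v N h t =
     Max ((\<lambda>x. (1 / h^2) * (k (x + 0.5 * h) * exp (theta k v x t * h)
                           + k (x - 0.5 * h) * exp (- theta k v x t * h))) ` grid_int N h)"

text \<open>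
  The operator used in the step from \<open>n \<tau>\<close> to \<open>(n + 1) \<tau>\<close> is \<open>A n\<close>. Since the coefficients are
  given on \<open>[0, T]\<close> only, the scheme consists of the steps with \<open>(n + 1) \<tau> \<le> T\<close>.
\<close>

definition scheme_solution ::
  "nat \<Rightarrow> real \<Rightarrow> real \<Rightarrow> real \<Rightarrow> real \<Rightarrow> (nat \<Rightarrow> (real \<Rightarrow> real) \<Rightarrow> real \<Rightarrow> real)
   \<Rightarrow> (real \<Rightarrow> real) \<Rightarrow> (nat \<Rightarrow> real \<Rightarrow> real) \<Rightarrow> (nat \<Rightarrow> real \<Rightarrow> real) \<Rightarrow> bool" where
  "scheme_solution N h T \<tau> \<sigma> A u0 \<phi> y \<longleftrightarrow>
     (\<forall>x\<in>grid_int N h. y 0 x = u0 x) \<and>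
     (\<forall>n. real n * \<tau> \<le> T \<longrightarrow> (\<forall>x\<in>grid_bdry N h. y n x = 0)) \<and>
     (\<forall>n. real (Suc n) * \<tau> \<le> T \<longrightarrow>
        (\<forall>x\<in>grid_int N h.
           (y (Suc n) x - y n x) / \<tau> + A n (\<lambda>z. \<sigma> * y (Suc n) z + (1 - \<sigma>) * y n z) x = \<phi> n x))"

definition scheme_uniquely_solvable ::
  "nat \<Rightarrow> real \<Rightarrow> real \<Rightarrow> real \<Rightarrow> real \<Rightarrow> (nat \<Rightarrow> (real \<Rightarrow> real) \<Rightarrow> real \<Rightarrow> real) \<Rightarrow> bool" where
  "scheme_uniquely_solvable N h T \<tau> \<sigma> A \<longleftrightarrow>
     (\<forall>u0 \<phi>. (\<exists>y. scheme_solution N h T \<tau> \<sigma> A u0 \<phi> y) \<and>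
        (\<forall>y z. scheme_solution N h T \<tau> \<sigma> A u0 \<phi> y \<longrightarrow> scheme_solution N h T \<tau> \<sigma> A u0 \<phi> z \<longrightarrow>
           (\<forall>n. real n * \<tau> \<le> T \<longrightarrow> (\<forall>x\<in>grid_int N h. y n x = z n x))))"

definition scheme_monotone ::
  "nat \<Rightarrow> real \<Rightarrow> real \<Rightarrow> real \<Rightarrow> real \<Rightarrow> (nat \<Rightarrow> (real \<Rightarrow> real) \<Rightarrow> real \<Rightarrow> real) \<Rightarrow> bool" where
  "scheme_monotone N h T \<tau> \<sigma> A \<longleftrightarrow>
     (\<forall>u0 \<phi> y. scheme_solution N h T \<tau> \<sigma> A u0 \<phi> y \<longrightarrow>
        (\<forall>x\<in>grid_int N h. u0 x \<ge> 0) \<longrightarrow>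
        (\<forall>n. real (Suc n) * \<tau> \<le> T \<longrightarrow> (\<forall>x\<in>grid_int N h. \<phi> n x \<ge> 0)) \<longrightarrow>
        (\<forall>n. real (Suc n) * \<tau> \<le> T \<longrightarrow> (\<forall>x\<in>grid_int N h. y (Suc n) x \<ge> 0)))"

text \<open>
  The time at which the coefficients are frozen in each step may be any point of the step
  interval, in particular the usual weighted one.
\<close>

lemma weighted_time_in_step:
  fixes \<sigma> \<tau> :: real
  assumes "0 \<le> \<sigma>" "\<sigma> \<le> 1" "0 < \<tau>"
  shows "\<sigma> * (real (Suc n) * \<tau>) + (1 - \<sigma>) * (real n * \<tau>) \<in> {real n * \<tau>..real (Suc n) * \<tau>}"
proof -
  have "\<sigma> * (real (Suc n) * \<tau>) + (1 - \<sigma>) * (real n * \<tau>) = real n * \<tau> + \<sigma> * \<tau>"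
    by (simp add: algebra_simps)
  moreover have "0 \<le> \<sigma> * \<tau>" "\<sigma> * \<tau> \<le> \<tau>"
    using assms by (auto simp: mult_left_le_one_le)
  ultimately show ?thesis
    by (simp add: algebra_simps)
qed

end

theory Submission
  imports Defs
begin

text \<open>
  Write \<open>A = D - C\<close> with \<open>D\<close> diagonal and \<open>C\<close> entrywise nonnegative. The matrix of (b) is the
  transpose of that of (a), and the row sums of \<open>C\<close> in (a), hence the column sums in (b), are at
  most the diagonal entries of \<open>D\<close>. The time-step constraint makes the explicit part of a step
  \<open>(1 + \<sigma>\<tau>D) y\<^sup>+ = \<sigma>\<tau>C y\<^sup>+ + (1 - (1-\<sigma>)\<tau>D) y + (1-\<sigma>)\<tau>C y + \<tau>\<phi>\<close> entrywise nonnegative.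
  In (a) the equation is then examined where \<open>y\<^sup>+\<close> is extremal; in (b) it is summed over the grid.
\<close>

section \<open>Linear systems on a finite index set and comparison principles\<close>

text \<open>
  The new pivot of the induction is nonzero, since otherwise the system on \<open>insert a F\<close> would
  have a kernel vector with entry 1 at \<open>a\<close>.
\<close>

lemma linear_system_solvable:
  fixes B :: "'a \<Rightarrow> 'a \<Rightarrow> 'b::field"
  assumes "finite G"
    and "\<And>H w x. H \<subseteq> G \<Longrightarrow> \<forall>x\<in>H. (\<Sum>z\<in>H. B x z * w z) = 0 \<Longrightarrow> x \<in> H \<Longrightarrow> w x = 0"
  shows "\<exists>w. \<forall>x\<in>G. (\<Sum>z\<in>G. B x z * w z) = f x"
  using assms
proof (induction arbitrary: f rule: finite_induct)
  case empty
  then show ?case by simp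
next
  case (insert a F)
  have solv: "\<exists>w. \<forall>x\<in>F. (\<Sum>z\<in>F. B x z * w z) = g x" for g
    by (rule insert.IH) (use insert.prems in blast)
  \<comment> \<open>With \<open>w1\<close> solving for the right-hand side \<open>f\<close> and
    \<open>w2\<close> for the column of \<open>a\<close>, the vector with value \<open>c\<close> at
    \<open>a\<close> and \<open>w1 - c * w2\<close> on \<open>F\<close> satisfies all rows of
    \<open>F\<close>. Row \<open>a\<close> then determines \<open>c\<close>.\<close>
  obtain w1 where w1: "\<And>x. x \<in> F \<Longrightarrow> (\<Sum>z\<in>F. B x z * w1 z) = f x"
    using solv[of f] by blast
  obtain w2 where w2: "\<And>x. x \<in> F \<Longrightarrow> (\<Sum>z\<in>F. B x z * w2 z) = B x a"
    using solv[of "\<lambda>x. B x a"] by blast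
  define pivot where "pivot = B a a - (\<Sum>z\<in>F. B a z * w2 z)"
  \<comment> \<open>Used twice: with \<open>c = 1\<close> and \<open>u = 0\<close> for the kernel
    vector, and with \<open>u = w1\<close> for the solution.\<close>
  have sum_eq: "(\<Sum>z\<in>insert a F. B x z * (if z = a then c else u z - c * w2 z))
      = B x a * c + (\<Sum>z\<in>F. B x z * u z) - c * (\<Sum>z\<in>F. B x z * w2 z)" for x c u
  proof -
    have "(\<Sum>z\<in>F. B x z * (if z = a then c else u z - c * w2 z))
        = (\<Sum>z\<in>F. B x z * u z - c * (B x z * w2 z))"
      using insert.hyps by (intro sum.cong) (auto simp: algebra_simps)
    then show ?thesis
      using insert.hyps by (simp add: sum_subtractf sum_distrib_left)
  qed
  have "pivot \<noteq> 0"
  proof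
    assume "pivot = 0"
    then have "\<forall>x\<in>insert a F.
        (\<Sum>z\<in>insert a F. B x z * (if z = a then 1 else 0 - 1 * w2 z)) = 0"
      unfolding sum_eq[of _ 1 "\<lambda>_. 0"] by (auto simp: w2 pivot_def)
    from insert.prems[OF subset_refl this, of a] show False by simp
  qed
  define c where "c = (f a - (\<Sum>z\<in>F. B a z * w1 z)) / pivot"
  have "c * pivot = f a - (\<Sum>z\<in>F. B a z * w1 z)"
    using \<open>pivot \<noteq> 0\<close> by (simp add: c_def)
  then have "B a a * c + (\<Sum>z\<in>F. B a z * w1 z) - c * (\<Sum>z\<in>F. B a z * w2 z) = f a"
    unfolding pivot_def by (simp add: algebra_simps)
  then have "\<forall>x\<in>insert a F.
      (\<Sum>z\<in>insert a F. B x z * (if z = a then c else w1 z - c * w2 z)) = f x"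
    unfolding sum_eq[of _ c w1] by (auto simp: w1 w2)
  then show ?case by (rule exI[of _ "\<lambda>z. if z = a then c else w1 z - c * w2 z"])
qed

text \<open>At a point \<open>m\<close> where \<open>w\<close> attains its maximum \<open>M\<close>,
  the row bound gives at most \<open>d m * M + b\<close> on the right, and \<open>d m * M\<close>
  cancels.\<close>

lemma max_principle:
  fixes w :: "'a \<Rightarrow> real"
  assumes "finite G" "x \<in> G" "0 \<le> b"
    and c: "\<And>x z. x \<in> G \<Longrightarrow> z \<in> G \<Longrightarrow> 0 \<le> c x z"
    and row: "\<And>x. x \<in> G \<Longrightarrow> (\<Sum>z\<in>G. c x z) \<le> d x"
    and w: "\<And>x. x \<in> G \<Longrightarrow> (1 + d x) * w x \<le> (\<Sum>z\<in>G. c x z * w z) + b"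
  shows "w x \<le> b"
proof -
  define M where "M = Max (w ` G)"
  have le: "w z \<le> M" if "z \<in> G" for z
    using that \<open>finite G\<close> by (simp add: M_def)
  have "M \<in> w ` G"
    unfolding M_def using assms(1,2) by (intro Max_in) auto
  then obtain m where m: "m \<in> G" "w m = M" by auto
  \<comment> \<open>The row bound may be multiplied by \<open>M\<close> only if \<open>M\<close> is
    positive; otherwise \<open>0 \<le> b\<close> already gives the claim.\<close>
  have "M \<le> b" if "M > 0"
  proof -
    have "(1 + d m) * M \<le> (\<Sum>z\<in>G. c m z * w z) + b"
      using w[OF m(1)] m(2) by simp
    also have "(\<Sum>z\<in>G. c m z * w z) \<le> (\<Sum>z\<in>G. c m z) * M"
      unfolding sum_distrib_right using c m(1) le by (intro sum_mono mult_left_mono) auto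
    also have "\<dots> \<le> d m * M"
      using row[OF m(1)] that by (intro mult_right_mono) auto
    finally show ?thesis by (simp add: algebra_simps)
  qed
  then show ?thesis using le[OF \<open>x \<in> G\<close>] \<open>0 \<le> b\<close> by linarith
qed

lemma sum_swap_le:
  fixes w :: "'a \<Rightarrow> real"
  assumes "\<And>z. z \<in> G \<Longrightarrow> (\<Sum>x\<in>G. c x z) \<le> d z" and "\<And>z. z \<in> G \<Longrightarrow> 0 \<le> w z"
  shows "(\<Sum>x\<in>G. \<Sum>z\<in>G. c x z * w z) \<le> (\<Sum>z\<in>G. d z * w z)"
proof -
  have "(\<Sum>x\<in>G. \<Sum>z\<in>G. c x z * w z) = (\<Sum>z\<in>G. (\<Sum>x\<in>G. c x z) * w z)"
    unfolding sum_distrib_right by (rule sum.swap)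
  also have "\<dots> \<le> (\<Sum>z\<in>G. d z * w z)"
    using assms by (intro sum_mono mult_right_mono) auto
  finally show ?thesis .
qed

text \<open>The positive parts of \<open>w\<close> satisfy the same inequalities; summed over
  \<open>G\<close>, the terms with \<open>d\<close> cancel against the column sums. For
  \<open>b = 0\<close> the conclusion forces \<open>w\<close> to be nonpositive, and for nonnegative
  \<open>w\<close> it is a bound on the sum of \<open>w\<close>.\<close>

lemma sum_principle:
  fixes w :: "'a \<Rightarrow> real"
  assumes c: "\<And>x z. x \<in> G \<Longrightarrow> z \<in> G \<Longrightarrow> 0 \<le> c x z"
    and col: "\<And>z. z \<in> G \<Longrightarrow> (\<Sum>x\<in>G. c x z) \<le> d z"
    and b: "\<And>x. x \<in> G \<Longrightarrow> 0 \<le> b x"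
    and w: "\<And>x. x \<in> G \<Longrightarrow> (1 + d x) * w x \<le> (\<Sum>z\<in>G. c x z * w z) + b x"
  shows "(\<Sum>x\<in>G. max 0 (w x)) \<le> (\<Sum>x\<in>G. b x)"
proof -
  have "(1 + d x) * max 0 (w x) \<le> (\<Sum>z\<in>G. c x z * max 0 (w z)) + b x" if x: "x \<in> G" for x
  \<comment> \<open>Where \<open>w x\<close> is nonpositive the left side is zero and the right side
    is nonnegative; elsewhere the positive parts only enlarge the sum.\<close>
  proof (cases "w x \<le> 0")
    case True
    then show ?thesis using c b x by (simp add: max_def sum_nonneg)
  next
    case False
    then have "(1 + d x) * max 0 (w x) \<le> (\<Sum>z\<in>G. c x z * w z) + b x"
      using w[OF x] by (simp add: max_def)
    also have "(\<Sum>z\<in>G. c x z * w z) \<le> (\<Sum>z\<in>G. c x z * max 0 (w z))"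
      using c x by (intro sum_mono mult_left_mono) auto
    finally show ?thesis by simp
  qed
  then have "(\<Sum>x\<in>G. (1 + d x) * max 0 (w x)) \<le> (\<Sum>x\<in>G. (\<Sum>z\<in>G. c x z * max 0 (w z)) + b x)"
    by (rule sum_mono)
  also have "\<dots> \<le> (\<Sum>x\<in>G. d x * max 0 (w x)) + (\<Sum>x\<in>G. b x)"
    unfolding sum.distrib using sum_swap_le[of G c d "\<lambda>z. max 0 (w z)"] col by simp
  finally show ?thesis by (simp add: algebra_simps sum.distrib)
qed

section \<open>The grid and the norms\<close>

lemma finite_grid_int [simp]: "finite (grid_int N h)"
proof -
  have "grid_int N h = (\<lambda>i. real i * h) ` {1..<N}"
    by (auto simp: grid_int_def)
  then show ?thesis by simp
qed

lemma grid_int_ne: "N \<ge> 2 \<Longrightarrow> grid_int N h \<noteq> {}"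
  by (auto simp: grid_int_def intro!: exI[of _ 1])

text \<open>Interior points keep a full step from both ends, so the half points at which
  \<open>k\<close> is evaluated lie in the interval where \<open>k\<close> is positive.\<close>

lemma grid_int_bounds:
  assumes "h > 0" "x \<in> grid_int N h"
  shows "h \<le> x" "x \<le> real N * h - h"
proof -
  obtain i where i: "x = real i * h" "1 \<le> i" "i < N"
    using assms by (auto simp: grid_int_def)
  have "1 * h \<le> real i * h"
    using i assms by (intro mult_right_mono) auto
  then show "h \<le> x" using i by simp
  have "(real i + 1) * h \<le> real N * h"
    using i assms by (intro mult_right_mono) auto
  then show "x \<le> real N * h - h" using i by (simp add: algebra_simps)
qed

lemma grid_int_not_bdry: "h > 0 \<Longrightarrow> x \<in> grid_int N h \<Longrightarrow> x \<notin> grid_bdry N h"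
  using grid_int_bounds[of h x N] by (auto simp: grid_bdry_def)

lemma grid_shift:
  assumes "x \<in> grid_int N h"
  shows "x + h \<in> grid_int N h \<union> grid_bdry N h" "x - h \<in> grid_int N h \<union> grid_bdry N h"
proof -
  obtain i where i: "x = real i * h" "1 \<le> i" "i < N"
    using assms by (auto simp: grid_int_def)
  \<comment> \<open>The truncated subtraction \<open>i - 1\<close> is exact because
    \<open>1 \<le> i\<close>.\<close>
  have "x + h = real (i + 1) * h" "x - h = real (i - 1) * h"
    using i by (auto simp: algebra_simps)
  moreover have "real j * h \<in> grid_int N h \<union> grid_bdry N h" if "j \<le> N" for j
    using that by (cases "j = 0"; cases "j = N") (auto simp: grid_int_def grid_bdry_def)
  ultimately show "x + h \<in> grid_int N h \<union> grid_bdry N h" "x - h \<in> grid_int N h \<union> grid_bdry N h"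
    using i(2,3) by (metis Suc_eq_plus1 Suc_leI, metis less_imp_diff_less less_imp_le)
qed

lemma norm_inf_ge: "x \<in> grid_int N h \<Longrightarrow> \<bar>w x\<bar> \<le> norm_inf N h w"
  by (auto simp: norm_inf_def)

lemma norm_inf_le:
  "N \<ge> 2 \<Longrightarrow> (\<And>x. x \<in> grid_int N h \<Longrightarrow> \<bar>w x\<bar> \<le> b) \<Longrightarrow> norm_inf N h w \<le> b"
  using grid_int_ne[of N h] by (auto simp: norm_inf_def)

lemma norm_inf_nonneg: "N \<ge> 2 \<Longrightarrow> 0 \<le> norm_inf N h w"
  using grid_int_ne[of N h] norm_inf_ge abs_ge_zero order_trans by blast

lemma accumulate:
  fixes f g :: "nat \<Rightarrow> real"
  assumes "\<And>m. m \<le> n \<Longrightarrow> f (Suc m) \<le> f m + g m"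
  shows "f (Suc n) \<le> f 0 + (\<Sum>j=0..n. g j)"
  using assms
proof (induction n)
  case (Suc n)
  have "f (Suc n) \<le> f 0 + (\<Sum>j=0..n. g j)"
    by (rule Suc.IH) (use Suc.prems in simp)
  then show ?case using Suc.prems[of "Suc n"] by simp
qed simp

section \<open>Schemes with a splitting into diagonal and nonnegative parts\<close>

text \<open>The common setting of (a) and (b). The sum in \<open>A_eq\<close> runs over interior
  points only, which is correct for \<open>w\<close> vanishing on the boundary. The product form of
  \<open>time_step\<close> covers \<sigma> = 1 as well, where its left side is zero.\<close>

locale split_scheme =
  fixes N :: nat and h T \<tau> \<sigma> :: real
    and A :: "nat \<Rightarrow> (real \<Rightarrow> real) \<Rightarrow> real \<Rightarrow> real"
    and d :: "nat \<Rightarrow> real \<Rightarrow> real" and c :: "nat \<Rightarrow> real \<Rightarrow> real \<Rightarrow> real"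
  assumes h_pos: "h > 0" and \<tau>_pos: "\<tau> > 0"
    and \<sigma>_nonneg: "0 \<le> \<sigma>" and \<sigma>_le_1: "\<sigma> \<le> 1"
    and A_eq: "\<And>n w x. \<forall>x\<in>grid_bdry N h. w x = 0 \<Longrightarrow> x \<in> grid_int N h \<Longrightarrow>
      A n w x = d n x * w x - (\<Sum>z\<in>grid_int N h. c n x z * w z)"
    and c_nonneg: "\<And>n x z. x \<in> grid_int N h \<Longrightarrow> z \<in> grid_int N h \<Longrightarrow> 0 \<le> c n x z"
    and time_step: "\<And>n x. real (Suc n) * \<tau> \<le> T \<Longrightarrow> x \<in> grid_int N h \<Longrightarrow> (1 - \<sigma>) * \<tau> * d n x \<le> 1"
begin

abbreviation G :: "real set" where "G \<equiv> grid_int N h"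

text \<open>All terms of a step, multiplied by \<tau>, that involve only the old layer and the
  source.\<close>

definition explicit_part :: "nat \<Rightarrow> (real \<Rightarrow> real) \<Rightarrow> (real \<Rightarrow> real) \<Rightarrow> real \<Rightarrow> real" where
  "explicit_part n y \<phi> x =
    (1 - (1 - \<sigma>) * \<tau> * d n x) * y x + (1 - \<sigma>) * \<tau> * (\<Sum>z\<in>G. c n x z * y z) + \<tau> * \<phi> x"

lemma step_iff:
  assumes "\<forall>x\<in>grid_bdry N h. y x = 0" "\<forall>x\<in>grid_bdry N h. y' x = 0" "x \<in> G"
  shows "(y' x - y x) / \<tau> + A n (\<lambda>z. \<sigma> * y' z + (1 - \<sigma>) * y z) x = \<phi> x \<longleftrightarrow>
    (1 + \<sigma> * \<tau> * d n x) * y' x = \<sigma> * \<tau> * (\<Sum>z\<in>G. c n x z * y' z) + explicit_part n y \<phi> x"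
proof -
  define S' S where "S' = (\<Sum>z\<in>G. c n x z * y' z)" and "S = (\<Sum>z\<in>G. c n x z * y z)"
  have "(\<Sum>z\<in>G. c n x z * (\<sigma> * y' z + (1 - \<sigma>) * y z)) = \<sigma> * S' + (1 - \<sigma>) * S"
    unfolding S'_def S_def sum_distrib_left sum.distrib[symmetric]
    by (intro sum.cong) (auto simp: algebra_simps)
  then have A: "A n (\<lambda>z. \<sigma> * y' z + (1 - \<sigma>) * y z) x
      = d n x * (\<sigma> * y' x + (1 - \<sigma>) * y x) - (\<sigma> * S' + (1 - \<sigma>) * S)"
    using assms by (subst A_eq) auto
  have "(y' x - y x) / \<tau> + X = \<phi> x \<longleftrightarrow> y' x = y x - \<tau> * X + \<tau> * \<phi> x" for X
    using \<tau>_pos by (auto simp: field_simps)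
  note this[of "d n x * (\<sigma> * y' x + (1 - \<sigma>) * y x) - (\<sigma> * S' + (1 - \<sigma>) * S)"]
  also have "y' x = y x - \<tau> * (d n x * (\<sigma> * y' x + (1 - \<sigma>) * y x) - (\<sigma> * S' + (1 - \<sigma>) * S)) + \<tau> * \<phi> x
      \<longleftrightarrow> (1 + \<sigma> * \<tau> * d n x) * y' x = \<sigma> * \<tau> * S' + explicit_part n y \<phi> x"
    unfolding explicit_part_def S_def[symmetric] by (auto simp: algebra_simps)
  finally show ?thesis unfolding A S'_def .
qed

lemma earlier: "real (Suc n) * \<tau> \<le> T \<Longrightarrow> m \<le> Suc n \<Longrightarrow> real m * \<tau> \<le> T"
  by (meson \<tau>_pos less_imp_le mult_right_mono of_nat_mono order_trans)

text \<open>Reduces the scheme to one linear system per layer. The boundary values of both layers of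
  a step are available because both times are at most \<open>T\<close>.\<close>

lemma solution_iff:
  "scheme_solution N h T \<tau> \<sigma> A u0 \<phi> y \<longleftrightarrow>
     (\<forall>x\<in>G. y 0 x = u0 x) \<and>
     (\<forall>n. real n * \<tau> \<le> T \<longrightarrow> (\<forall>x\<in>grid_bdry N h. y n x = 0)) \<and>
     (\<forall>n. real (Suc n) * \<tau> \<le> T \<longrightarrow> (\<forall>x\<in>G. (1 + \<sigma> * \<tau> * d n x) * y (Suc n) x
        = \<sigma> * \<tau> * (\<Sum>z\<in>G. c n x z * y (Suc n) z) + explicit_part n (y n) (\<phi> n) x))"
proof -
  have "(y (Suc n) x - y n x) / \<tau> + A n (\<lambda>z. \<sigma> * y (Suc n) z + (1 - \<sigma>) * y n z) x = \<phi> n x \<longleftrightarrow>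
      (1 + \<sigma> * \<tau> * d n x) * y (Suc n) x
        = \<sigma> * \<tau> * (\<Sum>z\<in>G. c n x z * y (Suc n) z) + explicit_part n (y n) (\<phi> n) x"
    if "\<forall>n. real n * \<tau> \<le> T \<longrightarrow> (\<forall>x\<in>grid_bdry N h. y n x = 0)" "real (Suc n) * \<tau> \<le> T" "x \<in> G"
    for n x
    using that earlier[of n n] by (intro step_iff) simp_all
  then show ?thesis
    unfolding scheme_solution_def by blast
qed

lemma solution_step:
  assumes "scheme_solution N h T \<tau> \<sigma> A u0 \<phi> y" "real (Suc n) * \<tau> \<le> T" "x \<in> G"
  shows "(1 + \<sigma> * \<tau> * d n x) * y (Suc n) x
    = \<sigma> * \<tau> * (\<Sum>z\<in>G. c n x z * y (Suc n) z) + explicit_part n (y n) (\<phi> n) x"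
  using assms unfolding solution_iff by blast

lemma explicit_part_nonneg:
  assumes "real (Suc n) * \<tau> \<le> T" "x \<in> G" "\<And>x. x \<in> G \<Longrightarrow> 0 \<le> y x" "0 \<le> \<phi> x"
  shows "0 \<le> explicit_part n y \<phi> x"
proof -
  have "0 \<le> (1 - (1 - \<sigma>) * \<tau> * d n x) * y x"
    using time_step assms by (intro mult_nonneg_nonneg) auto
  moreover have "0 \<le> (1 - \<sigma>) * \<tau> * (\<Sum>z\<in>G. c n x z * y z)"
    using \<sigma>_le_1 \<tau>_pos c_nonneg assms by (intro mult_nonneg_nonneg sum_nonneg) auto
  ultimately show ?thesis
    using \<tau>_pos assms by (simp add: explicit_part_def)
qed

text \<open>Every coefficient of the step is nonnegative, so the triangle inequality yields an
  inequality for the absolute values in exactly the form that the comparison principles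
  accept.\<close>

lemma abs_step:
  assumes y: "scheme_solution N h T \<tau> \<sigma> A u0 \<phi> y" and n: "real (Suc n) * \<tau> \<le> T" and x: "x \<in> G"
    and d: "0 \<le> d n x"
  shows "(1 + \<sigma> * \<tau> * d n x) * \<bar>y (Suc n) x\<bar> \<le> \<sigma> * \<tau> * (\<Sum>z\<in>G. c n x z * \<bar>y (Suc n) z\<bar>)
    + explicit_part n (\<lambda>z. \<bar>y n z\<bar>) (\<lambda>z. \<bar>\<phi> n z\<bar>) x"
proof -
  have abs_sum: "\<bar>\<Sum>z\<in>G. c n x z * w z\<bar> \<le> (\<Sum>z\<in>G. c n x z * \<bar>w z\<bar>)" for w :: "real \<Rightarrow> real"
    by (rule order_trans[OF sum_abs]) (use c_nonneg x in \<open>simp add: abs_mult\<close>)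
  have abs_mult_le: "\<bar>a * b\<bar> \<le> a * b'" if "\<bar>b\<bar> \<le> b'" "0 \<le> a" for a b b' :: real
    using that by (simp add: abs_mult mult_left_mono)
  have pos: "0 \<le> \<sigma> * \<tau>" "0 \<le> (1 - \<sigma>) * \<tau>" "0 \<le> 1 - (1 - \<sigma>) * \<tau> * d n x"
    using \<sigma>_nonneg \<sigma>_le_1 \<tau>_pos time_step[OF n x] by auto
  have "(1 + \<sigma> * \<tau> * d n x) * \<bar>y (Suc n) x\<bar> = \<bar>(1 + \<sigma> * \<tau> * d n x) * y (Suc n) x\<bar>"
    using d pos by (simp add: abs_mult)
  also have "(1 + \<sigma> * \<tau> * d n x) * y (Suc n) x
      = \<sigma> * \<tau> * (\<Sum>z\<in>G. c n x z * y (Suc n) z) + explicit_part n (y n) (\<phi> n) x"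
    by (rule solution_step[OF y n x])
  also have "\<bar>\<dots>\<bar> \<le> \<bar>\<sigma> * \<tau> * (\<Sum>z\<in>G. c n x z * y (Suc n) z)\<bar>
      + (\<bar>(1 - (1 - \<sigma>) * \<tau> * d n x) * y n x\<bar> + \<bar>(1 - \<sigma>) * \<tau> * (\<Sum>z\<in>G. c n x z * y n z)\<bar>
         + \<bar>\<tau> * \<phi> n x\<bar>)"
    unfolding explicit_part_def by linarith
  also have "\<dots> \<le> \<sigma> * \<tau> * (\<Sum>z\<in>G. c n x z * \<bar>y (Suc n) z\<bar>)
      + explicit_part n (\<lambda>z. \<bar>y n z\<bar>) (\<lambda>z. \<bar>\<phi> n z\<bar>) x"
  proof -
    have "\<bar>\<sigma> * \<tau> * (\<Sum>z\<in>G. c n x z * y (Suc n) z)\<bar> \<le> \<sigma> * \<tau> * (\<Sum>z\<in>G. c n x z * \<bar>y (Suc n) z\<bar>)"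
      using abs_sum pos(1) by (rule abs_mult_le)
    moreover have "\<bar>(1 - \<sigma>) * \<tau> * (\<Sum>z\<in>G. c n x z * y n z)\<bar> \<le> (1 - \<sigma>) * \<tau> * (\<Sum>z\<in>G. c n x z * \<bar>y n z\<bar>)"
      using abs_sum pos(2) by (rule abs_mult_le)
    moreover have "\<bar>(1 - (1 - \<sigma>) * \<tau> * d n x) * y n x\<bar> \<le> (1 - (1 - \<sigma>) * \<tau> * d n x) * \<bar>y n x\<bar>"
      using order_refl pos(3) by (rule abs_mult_le)
    moreover have "\<bar>\<tau> * \<phi> n x\<bar> \<le> \<tau> * \<bar>\<phi> n x\<bar>"
      using order_refl \<tau>_pos[THEN less_imp_le] by (rule abs_mult_le)
    ultimately show ?thesis unfolding explicit_part_def by linarith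
  qed
  finally show ?thesis .
qed

end

section \<open>Unique solvability and monotonicity from inverse positivity\<close>

text \<open>\<open>nonpos\<close> is inverse positivity of \<open>1 + r (D - C)\<close>, as for
  M-matrices. It is asked for every principal submatrix, indexed by \<open>H\<close>, since the
  elimination in \<open>linear_system_solvable\<close> passes through these.\<close>

locale inverse_positive_scheme = split_scheme +
  assumes nonpos: "\<And>n r w H x. 0 \<le> r \<Longrightarrow> H \<subseteq> G \<Longrightarrow>
      \<forall>x\<in>H. (1 + r * d n x) * w x \<le> r * (\<Sum>z\<in>H. c n x z * w z) \<Longrightarrow> x \<in> H \<Longrightarrow> w x \<le> 0"
begin

text \<open>Inverse positivity applied to both \<open>w\<close> and \<open>- w\<close>.\<close>

lemma implicit_kernel:
  assumes "H \<subseteq> G" "x \<in> H"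
    and eq: "\<And>x. x \<in> H \<Longrightarrow> (1 + \<sigma> * \<tau> * d n x) * w x = \<sigma> * \<tau> * (\<Sum>z\<in>H. c n x z * w z)"
  shows "w x = 0"
proof -
  have r: "0 \<le> \<sigma> * \<tau>" using \<sigma>_nonneg \<tau>_pos by simp
  have "w x \<le> 0"
    by (intro nonpos[OF r \<open>H \<subseteq> G\<close> _ \<open>x \<in> H\<close>, of n]) (simp add: eq)
  moreover have "- w x \<le> 0"
    by (intro nonpos[OF r \<open>H \<subseteq> G\<close> _ \<open>x \<in> H\<close>, of n]) (simp add: eq sum_negf)
  ultimately show ?thesis by simp
qed

lemma implicit_solvable:
  "\<exists>w. \<forall>x\<in>G. (1 + \<sigma> * \<tau> * d n x) * w x = \<sigma> * \<tau> * (\<Sum>z\<in>G. c n x z * w z) + f x"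
proof -
  \<comment> \<open>The matrix \<open>1 + \<sigma>\<tau>(D - C)\<close> of the implicit
    part.\<close>
  define B where "B x z = (if z = x then 1 + \<sigma> * \<tau> * d n x else 0) - \<sigma> * \<tau> * c n x z" for x z
  have B_sum: "(\<Sum>z\<in>H. B x z * w z) = (1 + \<sigma> * \<tau> * d n x) * w x - \<sigma> * \<tau> * (\<Sum>z\<in>H. c n x z * w z)"
    if "H \<subseteq> G" "x \<in> H" for H x w
  proof -
    have "finite H" using that(1) by (rule finite_subset) simp
    have "(\<Sum>z\<in>H. B x z * w z)
        = (\<Sum>z\<in>H. (if z = x then (1 + \<sigma> * \<tau> * d n x) * w x else 0) - \<sigma> * \<tau> * (c n x z * w z))"
      by (intro sum.cong) (auto simp: B_def algebra_simps)
    then show ?thesis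
      using \<open>finite H\<close> that by (simp add: sum_subtractf sum_distrib_left)
  qed
  have "\<exists>w. \<forall>x\<in>G. (\<Sum>z\<in>G. B x z * w z) = f x"
  proof (rule linear_system_solvable)
    fix H w x assume H: "H \<subseteq> G" "\<forall>x\<in>H. (\<Sum>z\<in>H. B x z * w z) = 0" "x \<in> H"
    show "w x = 0"
      by (rule implicit_kernel[OF H(1,3)]) (use H B_sum in auto)
  qed simp
  then show ?thesis by (simp add: B_sum diff_eq_eq add.commute)
qed

text \<open>Existence: the layers are chosen successively by \<open>implicit_solvable\<close>.
  Uniqueness: if two solutions agree at layer \<open>n\<close>, their explicit parts agree, and the
  difference of the next layers lies in the trivial kernel.\<close>

lemma uniquely_solvable: "scheme_uniquely_solvable N h T \<tau> \<sigma> A"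
  unfolding scheme_uniquely_solvable_def
proof (intro allI conjI impI)
  fix u0 \<phi>
  define step where "step n y y' \<longleftrightarrow> (\<forall>x\<in>G. (1 + \<sigma> * \<tau> * d n x) * y' x
      = \<sigma> * \<tau> * (\<Sum>z\<in>G. c n x z * y' z) + explicit_part n y (\<phi> n) x)" for n y y'
  \<comment> \<open>Dependent choice with the boundary condition as invariant; the clause for
    \<open>n = 0\<close> carries the initial condition. Layers are built for every \<open>n\<close>,
    and the restriction to times up to \<open>T\<close> enters only when the scheme is
    verified.\<close>
  have "\<exists>y. \<forall>n. ((\<forall>x\<in>grid_bdry N h. y n x = 0) \<and> (n = 0 \<longrightarrow> (\<forall>x\<in>G. y n x = u0 x)))
      \<and> step n (y n) (y (Suc n))"
  proof (rule dependent_nat_choice)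
    show "\<exists>y. (\<forall>x\<in>grid_bdry N h. y x = 0) \<and> ((0::nat) = 0 \<longrightarrow> (\<forall>x\<in>G. y x = u0 x))"
      by (intro exI[of _ "\<lambda>x. if x \<in> G then u0 x else 0"]) (use grid_int_not_bdry[OF h_pos] in auto)
  next
    fix y n
    obtain w where w: "step n y w"
      using implicit_solvable[of n "explicit_part n y (\<phi> n)"] unfolding step_def by blast
    \<comment> \<open>Resetting \<open>w\<close> to zero off the interior grid gives the boundary
      condition and leaves the sums over \<open>G\<close> unchanged.\<close>
    have "step n y (\<lambda>x. if x \<in> G then w x else 0)"
      using w unfolding step_def by (simp cong: sum.cong)
    moreover have "\<forall>x\<in>grid_bdry N h. (if x \<in> G then w x else 0) = 0"
      using grid_int_not_bdry[OF h_pos] by auto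
    ultimately show "\<exists>y'. ((\<forall>x\<in>grid_bdry N h. y' x = 0) \<and> (Suc n = 0 \<longrightarrow> (\<forall>x\<in>G. y' x = u0 x)))
        \<and> step n y y'"
      by (intro exI[of _ "\<lambda>x. if x \<in> G then w x else 0"]) auto
  qed
  then obtain y where y: "\<And>n. \<forall>x\<in>grid_bdry N h. y n x = 0" "\<forall>x\<in>G. y 0 x = u0 x"
      "\<And>n. step n (y n) (y (Suc n))"
    by metis
  then show "\<exists>y. scheme_solution N h T \<tau> \<sigma> A u0 \<phi> y"
    by (intro exI[of _ y]) (simp add: solution_iff step_def del: of_nat_Suc)
next
  fix u0 \<phi> y z n
  assume y: "scheme_solution N h T \<tau> \<sigma> A u0 \<phi> y" and z: "scheme_solution N h T \<tau> \<sigma> A u0 \<phi> z"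
  show "real n * \<tau> \<le> T \<Longrightarrow> \<forall>x\<in>G. y n x = z n x"
  proof (induction n)
    case 0
    then show ?case using y z by (simp add: solution_iff)
  next
    case (Suc n)
    have "\<forall>x\<in>G. y n x = z n x"
      using Suc.IH earlier[OF Suc.prems, of n] by simp
    then have expl: "explicit_part n (y n) (\<phi> n) x = explicit_part n (z n) (\<phi> n) x" if "x \<in> G" for x
      using that by (simp add: explicit_part_def)
    show ?case
    proof
      fix x assume x: "x \<in> G"
      have "y (Suc n) x - z (Suc n) x = 0"
      proof (rule implicit_kernel[OF subset_refl x])
        fix x assume x: "x \<in> G"
        show "(1 + \<sigma> * \<tau> * d n x) * (y (Suc n) x - z (Suc n) x)
            = \<sigma> * \<tau> * (\<Sum>v\<in>G. c n x v * (y (Suc n) v - z (Suc n) v))"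
          using solution_step[OF y Suc.prems x] solution_step[OF z Suc.prems x]
          by (simp add: expl[OF x] right_diff_distrib sum_subtractf)
      qed
      then show "y (Suc n) x = z (Suc n) x" by simp
    qed
  qed
qed

text \<open>By induction over the layers: a nonnegative old layer and source give a nonnegative
  explicit part, and inverse positivity applies to the negated new layer.\<close>

lemma monotone: "scheme_monotone N h T \<tau> \<sigma> A"
  unfolding scheme_monotone_def
proof (intro allI impI)
  fix u0 \<phi> y n
  assume y: "scheme_solution N h T \<tau> \<sigma> A u0 \<phi> y" and u0: "\<forall>x\<in>G. 0 \<le> u0 x"
    and \<phi>: "\<forall>n. real (Suc n) * \<tau> \<le> T \<longrightarrow> (\<forall>x\<in>G. 0 \<le> \<phi> n x)"
  have "real n * \<tau> \<le> T \<Longrightarrow> \<forall>x\<in>G. 0 \<le> y n x" for n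
  proof (induction n)
    case 0
    then show ?case using y u0 by (simp add: solution_iff)
  next
    case (Suc n)
    have yn: "\<forall>x\<in>G. 0 \<le> y n x"
      using Suc.IH earlier[OF Suc.prems, of n] by simp
    show ?case
    proof
      fix x assume x: "x \<in> G"
      have "- y (Suc n) x \<le> 0"
      proof (rule nonpos[OF _ subset_refl _ x])
        show "0 \<le> \<sigma> * \<tau>" using \<sigma>_nonneg \<tau>_pos by simp
        show "\<forall>x\<in>G. (1 + \<sigma> * \<tau> * d n x) * - y (Suc n) x \<le> \<sigma> * \<tau> * (\<Sum>z\<in>G. c n x z * - y (Suc n) z)"
        proof
          fix x assume x: "x \<in> G"
          have "0 \<le> explicit_part n (y n) (\<phi> n) x"
            using yn \<phi> x Suc.prems by (intro explicit_part_nonneg) auto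
          then show "(1 + \<sigma> * \<tau> * d n x) * - y (Suc n) x
              \<le> \<sigma> * \<tau> * (\<Sum>z\<in>G. c n x z * - y (Suc n) z)"
            using solution_step[OF y Suc.prems x] by (simp add: sum_negf)
        qed
      qed
      then show "0 \<le> y (Suc n) x" by simp
    qed
  qed
  then show "real (Suc n) * \<tau> \<le> T \<Longrightarrow> \<forall>x\<in>G. 0 \<le> y (Suc n) x" by blast
qed

end

section \<open>Row dominance and the maximum norm\<close>

locale row_dominant_scheme = split_scheme +
  assumes N_ge_2: "N \<ge> 2"
    and row_sum: "\<And>n x. x \<in> G \<Longrightarrow> (\<Sum>z\<in>G. c n x z) \<le> d n x"
begin

text \<open>The maximum principle on \<open>H\<close> with \<open>b = 0\<close>. Passing from
  \<open>G\<close> to \<open>H\<close> drops nonnegative entries, so row sums stay dominated by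
  \<open>d\<close>.\<close>

sublocale inverse_positive_scheme
proof unfold_locales
  fix n H x and r :: real and w :: "real \<Rightarrow> real"
  assume r: "0 \<le> r" and H: "H \<subseteq> G" "x \<in> H"
    and le: "\<forall>x\<in>H. (1 + r * d n x) * w x \<le> r * (\<Sum>z\<in>H. c n x z * w z)"
  show "w x \<le> 0"
  proof (rule max_principle[where G = H and w = w and b = 0 and c = "\<lambda>x z. r * c n x z" and d = "\<lambda>x. r * d n x"])
    fix x assume x: "x \<in> H"
    have "(\<Sum>z\<in>H. c n x z) \<le> (\<Sum>z\<in>G. c n x z)"
      using H x c_nonneg by (intro sum_mono2) auto
    then have "(\<Sum>z\<in>H. c n x z) \<le> d n x"
      using row_sum[of x n] H x by auto
    then show "(\<Sum>z\<in>H. r * c n x z) \<le> r * d n x"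
      using r by (simp add: sum_distrib_left[symmetric] mult_left_mono)
    show "(1 + r * d n x) * w x \<le> (\<Sum>z\<in>H. r * c n x z * w z) + 0"
      using le x by (simp add: sum_distrib_left mult.assoc)
  qed (use H r finite_subset[OF H(1)] in \<open>auto intro!: mult_nonneg_nonneg c_nonneg\<close>)
qed

lemma d_nonneg: "x \<in> G \<Longrightarrow> 0 \<le> d n x"
  using row_sum[of x n] sum_nonneg[of G "c n x"] c_nonneg by force

text \<open>The maximum principle for the absolute values of the new layer, with the right-hand side
  of the claim as the bound \<open>b\<close>.\<close>

lemma norm_inf_step:
  assumes y: "scheme_solution N h T \<tau> \<sigma> A u0 \<phi> y" and n: "real (Suc n) * \<tau> \<le> T"
  shows "norm_inf N h (y (Suc n)) \<le> norm_inf N h (y n) + \<tau> * norm_inf N h (\<phi> n)"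
proof (rule norm_inf_le[OF N_ge_2])
  fix x assume "x \<in> G"
  let ?Y = "norm_inf N h (y n)" and ?F = "norm_inf N h (\<phi> n)"
  have r: "0 \<le> \<sigma> * \<tau>" "0 \<le> (1 - \<sigma>) * \<tau>" using \<sigma>_nonneg \<sigma>_le_1 \<tau>_pos by auto
  show "\<bar>y (Suc n) x\<bar> \<le> ?Y + \<tau> * ?F"
  proof (rule max_principle[where G = G and w = "\<lambda>z. \<bar>y (Suc n) z\<bar>" and c = "\<lambda>x z. \<sigma> * \<tau> * c n x z"
        and d = "\<lambda>x. \<sigma> * \<tau> * d n x"])
    show "0 \<le> ?Y + \<tau> * ?F"
      using norm_inf_nonneg[OF N_ge_2] \<tau>_pos by simp
    fix x assume x: "x \<in> G"
    show "(\<Sum>z\<in>G. \<sigma> * \<tau> * c n x z) \<le> \<sigma> * \<tau> * d n x"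
      using row_sum[OF x] r(1) by (simp add: sum_distrib_left[symmetric] mult_left_mono)
    have "(\<Sum>z\<in>G. c n x z * \<bar>y n z\<bar>) \<le> (\<Sum>z\<in>G. c n x z) * ?Y"
      unfolding sum_distrib_right
      using c_nonneg x by (intro sum_mono mult_left_mono norm_inf_ge) auto
    also have "\<dots> \<le> d n x * ?Y"
      using row_sum[OF x] norm_inf_nonneg[OF N_ge_2] by (intro mult_right_mono) auto
    finally have "(1 - \<sigma>) * \<tau> * (\<Sum>z\<in>G. c n x z * \<bar>y n z\<bar>) \<le> (1 - \<sigma>) * \<tau> * (d n x * ?Y)"
      using r(2) by (rule mult_left_mono)
    moreover have "(1 - (1 - \<sigma>) * \<tau> * d n x) * \<bar>y n x\<bar> \<le> (1 - (1 - \<sigma>) * \<tau> * d n x) * ?Y"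
      using time_step[OF n x] x by (intro mult_left_mono norm_inf_ge) auto
    moreover have "\<tau> * \<bar>\<phi> n x\<bar> \<le> \<tau> * ?F"
      using \<tau>_pos x by (intro mult_left_mono norm_inf_ge) auto
    \<comment> \<open>The contributions \<open>(1 - \<sigma>) * \<tau> * d n x * ?Y\<close> of the
      first two estimates cancel.\<close>
    ultimately have "explicit_part n (\<lambda>z. \<bar>y n z\<bar>) (\<lambda>z. \<bar>\<phi> n z\<bar>) x \<le> ?Y + \<tau> * ?F"
      unfolding explicit_part_def by (simp add: left_diff_distrib mult.assoc)
    then show "(1 + \<sigma> * \<tau> * d n x) * \<bar>y (Suc n) x\<bar>
        \<le> (\<Sum>z\<in>G. \<sigma> * \<tau> * c n x z * \<bar>y (Suc n) z\<bar>) + (?Y + \<tau> * ?F)"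
      using abs_step[OF y n x d_nonneg[OF x]] by (simp add: sum_distrib_left mult.assoc)
  qed (use \<open>x \<in> G\<close> r c_nonneg in auto)
qed

lemma norm_inf_estimate:
  assumes y: "scheme_solution N h T \<tau> \<sigma> A u0 \<phi> y" and n: "real (Suc n) * \<tau> \<le> T"
  shows "norm_inf N h (y (Suc n)) \<le> norm_inf N h u0 + (\<Sum>j=0..n. \<tau> * norm_inf N h (\<phi> j))"
proof -
  have "norm_inf N h (y 0) = norm_inf N h u0"
    using y by (simp add: norm_inf_def solution_iff cong: image_cong_simp)
  then show ?thesis
    using accumulate[of n "\<lambda>m. norm_inf N h (y m)" "\<lambda>m. \<tau> * norm_inf N h (\<phi> m)"]
      norm_inf_step[OF y earlier[OF n]] by simp
qed

end

section \<open>Column dominance and the sum norm\<close>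

locale column_dominant_scheme = split_scheme +
  assumes column_sum: "\<And>n z. z \<in> G \<Longrightarrow> (\<Sum>x\<in>G. c n x z) \<le> d n z"
begin

text \<open>With \<open>b = 0\<close> the sum principle on \<open>H\<close> makes the sum of the
  positive parts of \<open>w\<close> at most zero, hence each of them vanishes.\<close>

sublocale inverse_positive_scheme
proof unfold_locales
  fix n H x and r :: real and w :: "real \<Rightarrow> real"
  assume r: "0 \<le> r" and H: "H \<subseteq> G" "x \<in> H"
    and le: "\<forall>x\<in>H. (1 + r * d n x) * w x \<le> r * (\<Sum>z\<in>H. c n x z * w z)"
  have fin: "finite H" using H(1) by (rule finite_subset) simp
  have "(\<Sum>x\<in>H. max 0 (w x)) \<le> (\<Sum>x\<in>H. 0)"
  proof (rule sum_principle[where c = "\<lambda>x z. r * c n x z" and d = "\<lambda>x. r * d n x"])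
    fix z assume z: "z \<in> H"
    have "(\<Sum>x\<in>H. c n x z) \<le> (\<Sum>x\<in>G. c n x z)"
      using H z c_nonneg by (intro sum_mono2) auto
    then have "(\<Sum>x\<in>H. c n x z) \<le> d n z"
      using column_sum[of z n] H z by auto
    then show "(\<Sum>x\<in>H. r * c n x z) \<le> r * d n z"
      using r by (simp add: sum_distrib_left[symmetric] mult_left_mono)
    show "(1 + r * d n z) * w z \<le> (\<Sum>v\<in>H. r * c n z v * w v) + 0"
      using le z by (simp add: sum_distrib_left mult.assoc)
  qed (use H r in \<open>auto intro!: mult_nonneg_nonneg c_nonneg\<close>)
  moreover have "max 0 (w x) \<le> (\<Sum>x\<in>H. max 0 (w x))"
    using fin H by (intro member_le_sum) auto
  ultimately show "w x \<le> 0" by simp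
qed

lemma d_nonneg: "z \<in> G \<Longrightarrow> 0 \<le> d n z"
  using column_sum[of z n] sum_nonneg[of G "\<lambda>x. c n x z"] c_nonneg by force

text \<open>The sum principle handles the implicit part; the explicit part is then summed over the
  grid.\<close>

lemma norm_one_step:
  assumes y: "scheme_solution N h T \<tau> \<sigma> A u0 \<phi> y" and n: "real (Suc n) * \<tau> \<le> T"
  shows "norm_one N h (y (Suc n)) \<le> norm_one N h (y n) + \<tau> * norm_one N h (\<phi> n)"
proof -
  let ?E = "explicit_part n (\<lambda>z. \<bar>y n z\<bar>) (\<lambda>z. \<bar>\<phi> n z\<bar>)"
  have r: "0 \<le> \<sigma> * \<tau>" "0 \<le> (1 - \<sigma>) * \<tau>" using \<sigma>_nonneg \<sigma>_le_1 \<tau>_pos by auto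
  have "(\<Sum>x\<in>G. max 0 \<bar>y (Suc n) x\<bar>) \<le> (\<Sum>x\<in>G. ?E x)"
  proof (rule sum_principle[where c = "\<lambda>x z. \<sigma> * \<tau> * c n x z" and d = "\<lambda>x. \<sigma> * \<tau> * d n x"])
    fix x assume x: "x \<in> G"
    show "(\<Sum>z\<in>G. \<sigma> * \<tau> * c n z x) \<le> \<sigma> * \<tau> * d n x"
      using column_sum[OF x] r(1) by (simp add: sum_distrib_left[symmetric] mult_left_mono)
    show "0 \<le> ?E x"
      using n x by (intro explicit_part_nonneg) auto
    show "(1 + \<sigma> * \<tau> * d n x) * \<bar>y (Suc n) x\<bar>
        \<le> (\<Sum>z\<in>G. \<sigma> * \<tau> * c n x z * \<bar>y (Suc n) z\<bar>) + ?E x"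
      using abs_step[OF y n x d_nonneg[OF x]] by (simp add: sum_distrib_left mult.assoc)
  qed (use r c_nonneg in auto)
  also have "(\<Sum>x\<in>G. ?E x) = (\<Sum>x\<in>G. \<bar>y n x\<bar>) - (1 - \<sigma>) * \<tau> * (\<Sum>x\<in>G. d n x * \<bar>y n x\<bar>)
      + (1 - \<sigma>) * \<tau> * (\<Sum>x\<in>G. \<Sum>z\<in>G. c n x z * \<bar>y n z\<bar>) + \<tau> * (\<Sum>x\<in>G. \<bar>\<phi> n x\<bar>)"
    unfolding explicit_part_def
    by (simp add: left_diff_distrib sum.distrib sum_subtractf sum_distrib_left mult.assoc)
  \<comment> \<open>By \<open>sum_swap_le\<close> the double sum is at most the sum of
    \<open>d n x * \<bar>y n x\<bar>\<close>, which is subtracted with the same factor.\<close>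
  also have "\<dots> \<le> (\<Sum>x\<in>G. \<bar>y n x\<bar>) + \<tau> * (\<Sum>x\<in>G. \<bar>\<phi> n x\<bar>)"
    using mult_left_mono[OF sum_swap_le[where c = "c n" and d = "d n" and w = "\<lambda>z. \<bar>y n z\<bar>"] r(2)]
      column_sum by simp
  finally show ?thesis by (simp add: norm_one_def)
qed

lemma norm_one_estimate:
  assumes y: "scheme_solution N h T \<tau> \<sigma> A u0 \<phi> y" and n: "real (Suc n) * \<tau> \<le> T"
  shows "norm_one N h (y (Suc n)) \<le> norm_one N h u0 + (\<Sum>j=0..n. \<tau> * norm_one N h (\<phi> j))"
proof -
  have "norm_one N h (y 0) = norm_one N h u0"
    using y by (simp add: norm_one_def solution_iff)
  then show ?thesis
    using accumulate[of n "\<lambda>m. norm_one N h (y m)" "\<lambda>m. \<tau> * norm_one N h (\<phi> m)"]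
      norm_one_step[OF y earlier[OF n]] by simp
qed

end

section \<open>The three-point operators and the theorem\<close>

text \<open>The matrix \<open>C\<close> of (a), with \<open>p\<close> for the right and
  \<open>q\<close> for the left neighbour. Swapping \<open>x\<close> and \<open>z\<close> gives that
  of (b).\<close>

definition neighbour_coeff :: "real \<Rightarrow> (real \<Rightarrow> real) \<Rightarrow> (real \<Rightarrow> real) \<Rightarrow> real \<Rightarrow> real \<Rightarrow> real" where
  "neighbour_coeff h p q x z = (if z = x + h then p x else 0) + (if z = x - h then q x else 0)"

text \<open>A neighbour missing from the interior grid is a boundary point, where \<open>w\<close>
  vanishes. The second identity is for the transpose, so \<open>p\<close> and \<open>q\<close> are
  evaluated at the neighbours.\<close>

lemma neighbour_sum:
  assumes w: "\<forall>x\<in>grid_bdry N h. w x = 0" and x: "x \<in> grid_int N h"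
  shows "(\<Sum>z\<in>grid_int N h. neighbour_coeff h p q x z * w z) = p x * w (x + h) + q x * w (x - h)"
    and "(\<Sum>z\<in>grid_int N h. neighbour_coeff h p q z x * w z)
      = q (x + h) * w (x + h) + p (x - h) * w (x - h)"
proof -
  have zero: "w (x + h) = 0 \<or> x + h \<in> grid_int N h" "w (x - h) = 0 \<or> x - h \<in> grid_int N h"
    using grid_shift[OF x] w by auto
  have "(\<Sum>z\<in>grid_int N h. neighbour_coeff h p q x z * w z)
      = (\<Sum>z\<in>grid_int N h. (if z = x + h then p x * w (x + h) else 0)
          + (if z = x - h then q x * w (x - h) else 0))"
    by (intro sum.cong) (auto simp: neighbour_coeff_def algebra_simps)
  then show "(\<Sum>z\<in>grid_int N h. neighbour_coeff h p q x z * w z) = p x * w (x + h) + q x * w (x - h)"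
    using zero by (auto simp: sum.distrib)
  have "(\<Sum>z\<in>grid_int N h. neighbour_coeff h p q z x * w z)
      = (\<Sum>z\<in>grid_int N h. (if z = x + h then q (x + h) * w (x + h) else 0)
          + (if z = x - h then p (x - h) * w (x - h) else 0))"
    by (intro sum.cong) (auto simp: neighbour_coeff_def algebra_simps)
  then show "(\<Sum>z\<in>grid_int N h. neighbour_coeff h p q z x * w z)
      = q (x + h) * w (x + h) + p (x - h) * w (x - h)"
    using zero by (auto simp: sum.distrib)
qed

lemma neighbour_coeff_nonneg: "0 \<le> p x \<Longrightarrow> 0 \<le> q x \<Longrightarrow> 0 \<le> neighbour_coeff h p q x z"
  by (simp add: neighbour_coeff_def)

text \<open>Only an inequality, since next to the boundary a neighbour drops out of the sum.\<close>

lemma neighbour_coeff_row_sum: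
  assumes "0 \<le> p x" "0 \<le> q x"
  shows "(\<Sum>z\<in>grid_int N h. neighbour_coeff h p q x z) \<le> p x + q x"
  using assms by (auto simp: neighbour_coeff_def sum.distrib)

theorem theorem27:
  fixes N :: nat and h l T \<kappa>1 \<tau> \<sigma> :: real
    and k :: "real \<Rightarrow> real" and v :: "real \<Rightarrow> real \<Rightarrow> real" and s :: "nat \<Rightarrow> real"
  assumes "N \<ge> 2" and "h > 0" and "real N * h = l" and "T > 0"
    and "\<kappa>1 > 0" and "\<And>x. x \<in> {0..l} \<Longrightarrow> k x \<ge> \<kappa>1"
    and "\<tau> > 0" and "0 \<le> \<sigma>" and "\<sigma> \<le> 1"
    and "\<And>n. real (Suc n) * \<tau> \<le> T \<Longrightarrow> s n \<in> {real n * \<tau>..real (Suc n) * \<tau>}"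
    and "\<And>n. \<sigma> < 1 \<Longrightarrow> real (Suc n) * \<tau> \<le> T \<Longrightarrow> \<tau> \<le> 1 / ((1 - \<sigma>) * gamma_max k v N h (s n))"
  shows
    "(let A = (\<lambda>n. op_a k v h (s n)) in
        scheme_uniquely_solvable N h T \<tau> \<sigma> A \<and>
        scheme_monotone N h T \<tau> \<sigma> A \<and>
        (\<forall>u0 \<phi> y. scheme_solution N h T \<tau> \<sigma> A u0 \<phi> y \<longrightarrow>
           (\<forall>n. real (Suc n) * \<tau> \<le> T \<longrightarrow>
              norm_inf N h (y (Suc n)) \<le> norm_inf N h u0 + (\<Sum>j=0..n. \<tau> * norm_inf N h (\<phi> j)))))
   \<and> (let A = (\<lambda>n. op_b k v h (s n)) in
        scheme_uniquely_solvable N h T \<tau> \<sigma> A \<and>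
        scheme_monotone N h T \<tau> \<sigma> A \<and>
        (\<forall>u0 \<phi> y. scheme_solution N h T \<tau> \<sigma> A u0 \<phi> y \<longrightarrow>
           (\<forall>n. real (Suc n) * \<tau> \<le> T \<longrightarrow>
              norm_one N h (y (Suc n)) \<le> norm_one N h u0 + (\<Sum>j=0..n. \<tau> * norm_one N h (\<phi> j)))))"
proof -
  \<comment> \<open>The coefficients of the two neighbours in (a). Their sum is the diagonal entry
    in both cases, and its maximum over the grid is \<open>gamma_max\<close>.\<close>
  define p where "p n x = (1 / h^2) * k (x + 0.5 * h) * exp (theta k v x (s n) * h)" for n x
  define q where "q n x = (1 / h^2) * k (x - 0.5 * h) * exp (- theta k v x (s n) * h)" for n x
  have pq_pos: "p n x > 0" "q n x > 0" if x: "x \<in> grid_int N h" for n x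
  proof -
    have "x + 0.5 * h \<in> {0..l}" "x - 0.5 * h \<in> {0..l}"
      using grid_int_bounds[OF assms(2) x] assms(2,3) by auto
    then have "k (x + 0.5 * h) > 0" "k (x - 0.5 * h) > 0"
      using assms(5,6) less_le_trans by blast+
    then show "p n x > 0" "q n x > 0"
      using assms(2) by (simp_all add: p_def q_def)
  qed
  have step: "(1 - \<sigma>) * \<tau> * (p n x + q n x) \<le> 1"
    if n: "real (Suc n) * \<tau> \<le> T" and x: "x \<in> grid_int N h" for n x
  proof (cases "\<sigma> < 1")
    case True
    let ?\<gamma> = "gamma_max k v N h (s n)"
    have le: "p n x + q n x \<le> ?\<gamma>"
      unfolding gamma_max_def using x
      by (intro Max_ge) (auto simp: p_def q_def algebra_simps)
    \<comment> \<open>Positivity of the denominator turns the quotient form of the constraint into a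
      product.\<close>
    then have "0 < (1 - \<sigma>) * ?\<gamma>"
      using pq_pos[OF x, of n] True by simp
    then have "(1 - \<sigma>) * \<tau> * ?\<gamma> \<le> 1"
      using assms(11)[OF True n] by (simp add: field_simps)
    moreover have "(1 - \<sigma>) * \<tau> * (p n x + q n x) \<le> (1 - \<sigma>) * \<tau> * ?\<gamma>"
      using le True assms(7) by (intro mult_left_mono) auto
    ultimately show ?thesis by linarith
  qed (use assms(9) in auto)
  have op_a: "op_a k v h (s n) w x
      = (p n x + q n x) * w x - (\<Sum>z\<in>grid_int N h. neighbour_coeff h (p n) (q n) x z * w z)"
    if "\<forall>x\<in>grid_bdry N h. w x = 0" "x \<in> grid_int N h" for n w x
    unfolding neighbour_sum(1)[OF that] op_a_def p_def q_def
    by (simp add: algebra_simps diff_divide_distrib)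
  interpret a: row_dominant_scheme N h T \<tau> \<sigma> "\<lambda>n. op_a k v h (s n)" "\<lambda>n x. p n x + q n x"
    "\<lambda>n. neighbour_coeff h (p n) (q n)"
    using assms(1,2,7-9) step pq_pos[THEN less_imp_le] op_a
    by unfold_locales (auto simp: neighbour_coeff_nonneg neighbour_coeff_row_sum)
  have op_b: "op_b k v h (s n) w x
      = (p n x + q n x) * w x - (\<Sum>z\<in>grid_int N h. neighbour_coeff h (p n) (q n) z x * w z)"
    if "\<forall>x\<in>grid_bdry N h. w x = 0" "x \<in> grid_int N h" for n w x
  proof -
    \<comment> \<open>The half point to the left of \<open>x + h\<close> is the one to the right of
      \<open>x\<close>, and symmetrically for \<open>x - h\<close>. Thus \<open>q\<close> at
      \<open>x + h\<close> and \<open>p\<close> at \<open>x - h\<close> are the neighbour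
      coefficients in (b).\<close>
    have "x + h - 0.5 * h = x + 0.5 * h" "x - h + 0.5 * h = x - 0.5 * h" by simp_all
    then show ?thesis
      unfolding neighbour_sum(2)[OF that] op_b_def p_def q_def
      by (simp add: algebra_simps)
  qed
  \<comment> \<open>The column sums of the transposed matrix are the row sums bounded by
    \<open>neighbour_coeff_row_sum\<close>.\<close>
  interpret b: column_dominant_scheme N h T \<tau> \<sigma> "\<lambda>n. op_b k v h (s n)" "\<lambda>n x. p n x + q n x"
    "\<lambda>n x z. neighbour_coeff h (p n) (q n) z x"
    using assms(1,2,7-9) step pq_pos[THEN less_imp_le] op_b
    by unfold_locales (auto simp: neighbour_coeff_nonneg neighbour_coeff_row_sum)
  show ?thesis
    unfolding Let_def
    by (intro conjI allI impI a.uniquely_solvable a.monotone a.norm_inf_estimate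
        b.uniquely_solvable b.monotone b.norm_one_estimate)
qed

end
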